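(* Let $n \geq 32$ and $p \geq 7$. Consider the Zeckendorf game on $n$ with $p$ players divided into two alliances: a big alliance with $p-2$ players and a small alliance with exactly $2$ players (in any positions). Then the big alliance always has a winning strategy.
   Context: Let $F_1=1$, $F_2=2$, $F_{i+1}=F_i+F_{i-1}$. The Zeckendorf game on $n$ starts with the multiset of $n$ copies of $1$. A move is one of: if the list contains $F_{i-1}$ and $F_i$, replace them by $F_{i+1}$; if the list contains two copies of $F_i$: for $i=1$ replace them by $F_2$; for $i=2$ replace them by $F_1,F_3$; for $i\geq 3$ replace them by $F_{i-2},F_{i+1}$. The game ends when the list is the Zeckendorf decomposition of $n$ (distinct, pairwise non-consecutive Fibonacci numbers); every game terminates. With $p$ players, players $1,\dots,p$ move in cyclic order $1,2,\dots,p,1,2,\dots$ starting with player 1. Players are partitioned into alliances; an alliance wins if the final move (creating the Zeckendorf decomposition) is made by one of its members. An alliance has a winning strategy if its members can choose their moves so that the final move is made by a member no matter what moves the other players make. *)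

theory Defs
  imports "HOL-Library.Multiset" "HOL-Number_Theory.Fib"
begin

text \<open>
  Fibonacci numbers with the indexing \<open>F 1 = 1\<close>, \<open>F 2 = 2\<close>, \<open>F 3 = 3\<close>, \<open>F 4 = 5\<close>, ...
  Only indices \<open>i \<ge> 1\<close> are meant; \<open>zfib\<close> is injective there.
\<close>
definition zfib :: "nat \<Rightarrow> nat" where
  "zfib i = fib (Suc i)"

inductive zmove :: "nat multiset \<Rightarrow> nat multiset \<Rightarrow> bool" where
  combine: "2 \<le> i \<Longrightarrow> zmove (M + {#zfib (i - 1), zfib i#}) (M + {#zfib (i + 1)#})"
| split1: "zmove (M + {#zfib 1, zfib 1#}) (M + {#zfib 2#})"
| split2: "zmove (M + {#zfib 2, zfib 2#}) (M + {#zfib 1, zfib 3#})"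
| split: "3 \<le> i \<Longrightarrow> zmove (M + {#zfib i, zfib i#}) (M + {#zfib (i - 2), zfib (i + 1)#})"

definition zeckendorf :: "nat \<Rightarrow> nat multiset \<Rightarrow> bool" where
  "zeckendorf n M \<longleftrightarrow> sum_mset M = n \<and>
     (\<exists>I. finite I \<and> (\<forall>i\<in>I. 1 \<le> i \<and> Suc i \<notin> I) \<and> M = image_mset zfib (mset_set I))"

text \<open>
  A (possibly unfinished) play is the nonempty list of the positions reached so far;
  move number \<open>k\<close>, counted from \<open>0\<close>, leads from \<open>h ! k\<close> to \<open>h ! Suc k\<close>.
\<close>
definition zplay :: "nat \<Rightarrow> nat multiset list \<Rightarrow> bool" where
  "zplay n h \<longleftrightarrow> h \<noteq> [] \<and> hd h = replicate_mset n 1 \<and>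
     (\<forall>k. Suc k < length h \<longrightarrow> \<not> zeckendorf n (h ! k) \<and> zmove (h ! k) (h ! Suc k))"

definition finished :: "nat \<Rightarrow> nat multiset list \<Rightarrow> bool" where
  "finished n h \<longleftrightarrow> zplay n h \<and> zeckendorf n (last h)"

definition mover :: "nat \<Rightarrow> nat \<Rightarrow> nat" where
  "mover p k = k mod p + 1"

text \<open>A strategy maps the play so far to the next position.\<close>
definition follows ::
    "nat \<Rightarrow> nat set \<Rightarrow> (nat multiset list \<Rightarrow> nat multiset) \<Rightarrow> nat multiset list \<Rightarrow> bool" where
  "follows p A \<sigma> h \<longleftrightarrow>
     (\<forall>k. Suc k < length h \<longrightarrow> mover p k \<in> A \<longrightarrow> h ! Suc k = \<sigma> (take (Suc k) h))"

text \<open>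
  In a play \<open>h\<close>, the next move is made by \<open>mover p (length h - 1)\<close> and the last move was made
  by \<open>mover p (length h - 2)\<close>. A play without any move is won by nobody. The first conjunct says
  that the strategy prescribes legal moves. Infinite plays need not be mentioned, since every
  play has bounded length (lemma \<open>zplay_length_le\<close> below), and plays never get stuck before
  they are finished (lemma \<open>zplay_progress\<close>).
\<close>
definition winning_strategy ::
    "nat \<Rightarrow> nat \<Rightarrow> nat set \<Rightarrow> (nat multiset list \<Rightarrow> nat multiset) \<Rightarrow> bool" where
  "winning_strategy n p A \<sigma> \<longleftrightarrow>
     (\<forall>h. zplay n h \<and> follows p A \<sigma> h \<and> \<not> finished n h \<and> mover p (length h - 1) \<in> A
          \<longrightarrow> zmove (last h) (\<sigma> h)) \<and>
     (\<forall>h. finished n h \<and> follows p A \<sigma> h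
          \<longrightarrow> 2 \<le> length h \<and> mover p (length h - 2) \<in> A)"

definition has_winning_strategy :: "nat \<Rightarrow> nat \<Rightarrow> nat set \<Rightarrow> bool" where
  "has_winning_strategy n p A \<longleftrightarrow> (\<exists>\<sigma>. winning_strategy n p A \<sigma>)"


lemma zfib_simps [simp]: "zfib 0 = 1" "zfib (Suc 0) = 1" "zfib (Suc (Suc i)) = zfib (Suc i) + zfib i"
  by (simp_all add: zfib_def)

lemma zfib_pos: "0 < zfib i"
  by (simp add: zfib_def fib_neq_0_nat)

lemma zmove_sum: "zmove M N \<Longrightarrow> sum_mset N = sum_mset M"
proof (induction rule: zmove.induct)
  case (combine i M)
  then obtain j where "i = Suc (Suc j)" by (metis add_2_eq_Suc le_Suc_ex)
  then show ?case by simp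
next
  case (split i M)
  then obtain j where "i = Suc (Suc (Suc j))" by (metis add_Suc le_Suc_ex numeral_3_eq_3 plus_nat.add_0)
  then show ?case by simp
qed (simp_all add: numeral_2_eq_2 numeral_3_eq_3)

lemma zmove_sum_squares:
  "zmove M N \<Longrightarrow> (\<Sum>x\<in>#M. x\<^sup>2) < (\<Sum>x\<in>#N. x\<^sup>2)"
proof (induction rule: zmove.induct)
  case (combine i M)
  then obtain j where "i = Suc (Suc j)" by (metis add_2_eq_Suc le_Suc_ex)
  then show ?case using zfib_pos[of j] zfib_pos[of "Suc j"]
    by (simp add: power2_eq_square algebra_simps)
next
  case (split i M)
  then obtain j where "i = Suc (Suc (Suc j))" by (metis add_Suc le_Suc_ex numeral_3_eq_3 plus_nat.add_0)
  then show ?case using zfib_pos[of j] zfib_pos[of "Suc j"]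
    by (simp add: power2_eq_square algebra_simps)
qed (simp_all add: numeral_2_eq_2 numeral_3_eq_3 power2_eq_square)

lemma sum_squares_le: "(\<Sum>x\<in>#M. x\<^sup>2) \<le> (sum_mset M :: nat)\<^sup>2"
  by (induction M) (auto simp: power2_eq_square algebra_simps)

lemma zplay_nth:
  assumes "zplay n h" "k < length h"
  shows "sum_mset (h ! k) = n \<and> k \<le> (\<Sum>x\<in>#h ! k. x\<^sup>2) \<and> set_mset (h ! k) \<subseteq> zfib ` {1..}"
proof -
  have one: "(1::nat) \<in> zfib ` {1..}" by (rule image_eqI[of _ _ 1]) simp_all
  show ?thesis using assms(2)
  proof (induction k)
    case 0
    have "h ! 0 = replicate_mset n 1"
      using assms(1) by (metis zplay_def hd_conv_nth)
    then show ?case using one by (auto simp: in_replicate_mset)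
  next
    case (Suc k)
    then have mv: "zmove (h ! k) (h ! Suc k)" using assms(1) by (simp add: zplay_def)
    have "set_mset N \<subseteq> zfib ` {1..}" if "zmove M N" "set_mset M \<subseteq> zfib ` {1..}" for M N
      using that one
      by (induction rule: zmove.induct) auto
    with Suc mv zmove_sum[OF mv] zmove_sum_squares[OF mv] show ?case by simp
  qed
qed

lemma zplay_length_le:
  assumes "zplay n h"
  shows "length h \<le> n\<^sup>2 + 1"
proof -
  from assms have "length h - 1 < length h" by (simp add: zplay_def)
  from zplay_nth[OF assms this] sum_squares_le[of "h ! (length h - 1)"]
  have "length h - 1 \<le> n\<^sup>2" by simp
  then show ?thesis by simp
qed

lemma zfib_inj: "inj_on zfib {1..}"
proof -
  have "zfib i < zfib (Suc i)" if "1 \<le> i" for i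
    using that zfib_pos[of "i - 1"] by (cases i) simp_all
  then have "zfib i < zfib j" if "1 \<le> i" "i < j" for i j
    using that(2)
  proof (induction j)
    case (Suc j)
    then show ?case using \<open>\<And>i. 1 \<le> i \<Longrightarrow> zfib i < zfib (Suc i)\<close> that(1)
      by (metis less_SucE less_trans order_less_imp_le order_trans)
  qed simp
  then show ?thesis
    by (intro inj_onI) (metis atLeast_iff less_irrefl linorder_neqE_nat)
qed

lemma zplay_progress:
  assumes play: "zplay n h" and nz: "\<not> zeckendorf n (last h)"
  shows "\<exists>N. zmove (last h) N"
proof (rule ccontr)
  assume none: "\<nexists>N. zmove (last h) N"
  define M where "M = last h"
  have "h \<noteq> []" using play by (simp add: zplay_def)
  then have M: "sum_mset M = n" "set_mset M \<subseteq> zfib ` {1..}"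
    using zplay_nth[OF play, of "length h - 1"] by (simp_all add: M_def last_conv_nth)
  define I where "I = {i. 1 \<le> i \<and> zfib i \<in># M}"
  have img: "zfib ` I = set_mset M" using M(2) by (auto simp: I_def)
  have inj: "inj_on zfib I" by (rule inj_on_subset[OF zfib_inj]) (auto simp: I_def)
  have fin: "finite I" using finite_imageD[OF _ inj] img by simp
  have cnt: "count M x \<le> 1" for x
  proof (rule ccontr)
    assume "\<not> count M x \<le> 1"
    then have two: "2 \<le> count M x" by simp
    then have "x \<in># M" by (metis count_eq_zero_iff not_numeral_le_zero)
    then obtain i where i: "1 \<le> i" "x = zfib i" using M(2) by auto
    have "{#x, x#} \<subseteq># M" using two by (auto simp: subseteq_mset_def)
    then obtain K where K: "M = K + {#zfib i, zfib i#}"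
      using i by (metis subset_mset.diff_add)
    consider "i = 1" | "i = 2" | "3 \<le> i" using i(1) by linarith
    then show False
      using none K zmove.split1[of K] zmove.split2[of K] zmove.split[of i K]
      by (cases; auto simp: M_def)
  qed
  have noncons: "Suc i \<notin> I" if "i \<in> I" for i
  proof
    assume "Suc i \<in> I"
    have "zfib i \<noteq> zfib (Suc i)" using inj that \<open>Suc i \<in> I\<close> by (metis inj_onD n_not_Suc_n)
    moreover have "zfib i \<in># M" "zfib (Suc i) \<in># M" using that \<open>Suc i \<in> I\<close> by (simp_all add: I_def)
    ultimately have "M = (M - {#zfib i, zfib (Suc i)#}) + {#zfib i, zfib (Suc i)#}"
      by (metis add_mset_add_single add_mset_remove_trivial_eq insert_DiffM insert_noteq_member
          mset_subset_eq_insertD multi_member_split subset_mset.diff_add insert_subset_eq_iff single_subset_iff)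
    moreover have "2 \<le> Suc i" using that by (simp add: I_def)
    ultimately show False
      using none zmove.combine[of "Suc i" "M - {#zfib i, zfib (Suc i)#}"] by (auto simp: M_def)
  qed
  have "M = mset_set (set_mset M)"
  proof (rule multiset_eqI)
    fix x
    show "count M x = count (mset_set (set_mset M)) x"
      using cnt[of x] count_greater_zero_iff[of M x]
      by (cases "x \<in># M") (auto simp: not_in_iff count_mset_set' le_Suc_eq simp del: count_greater_zero_iff)
  qed
  also have "\<dots> = image_mset zfib (mset_set I)"
    using image_mset_mset_set[OF inj] img by simp
  finally have "zeckendorf n M"
    using M(1) fin noncons by (auto simp: zeckendorf_def I_def)
  with nz show False by (simp add: M_def)
qed

end

theory Submission
  imports Defs
begin

text \<open>
  Strategy stealing. The game is finite, so if the big alliance cannot win, then the small one can.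
  Suppose some consecutive players of the big alliance can lead one position \<open>M\<close> to the same
  position \<open>N\<close> in either \<open>j\<close> or \<open>j + k\<close> moves. Then the small alliance wins from \<open>N\<close> at two times
  that differ by \<open>k\<close>; in other words, the small alliance and its shift by \<open>k\<close> seats both win from
  \<open>N\<close>, which is absurd if they are disjoint.
  If the two small players are not neighbours, \<open>k = 1\<close> works: four 1s become \<open>{1, 3}\<close> in two or
  three moves. If they are neighbours, \<open>k = 2\<close> works: use this detour twice if there are six
  big players in a row; for \<open>p = 7\<close> there are only five, and \<open>{2} + 6 {1}\<close> becomes \<open>{1, 1, 3, 3}\<close>
  in three or five moves, where the 2 is left over from the five 2s that the big players
  created one round before.
\<close>

section \<open>Finite games played by two alliances\<close>

text \<open>\<open>P k\<close> says that move number \<open>k\<close> belongs to the alliance; \<open>wins R P t M\<close> that the alliance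
  can force making the last move from position \<open>M\<close> when move number \<open>t\<close> is next.\<close>
inductive wins :: "('a \<Rightarrow> 'a \<Rightarrow> bool) \<Rightarrow> (nat \<Rightarrow> bool) \<Rightarrow> nat \<Rightarrow> 'a \<Rightarrow> bool"
  for R P where
  final: "\<nexists>N. R M N \<Longrightarrow> P t \<Longrightarrow> wins R P (Suc t) M"
| own: "P t \<Longrightarrow> R M N \<Longrightarrow> wins R P (Suc t) N \<Longrightarrow> wins R P t M"
| other: "\<not> P t \<Longrightarrow> R M N' \<Longrightarrow> (\<And>N. R M N \<Longrightarrow> wins R P (Suc t) N) \<Longrightarrow> wins R P t M"

lemma wins_other_step: "wins R P t M \<Longrightarrow> \<not> P t \<Longrightarrow> R M N \<Longrightarrow> wins R P (Suc t) N"
  by (erule wins.cases) auto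

text \<open>Whoever is to move, a won position has a won successor: the alliance picks one, an
  opponent cannot avoid one. \<open>N'\<close> only rules out final positions.\<close>

lemma wins_some_step: "wins R P t M \<Longrightarrow> R M N' \<Longrightarrow> \<exists>N. R M N \<and> wins R P (Suc t) N"
  by (erule wins.cases) auto

lemma wins_final: "wins R P t M \<Longrightarrow> \<nexists>N. R M N \<Longrightarrow> \<exists>s. t = Suc s \<and> P s"
  by (erule wins.cases) auto

text \<open>At most one of the two alliances is to move, and one that is not to move wins after any
  move, so some move preserves both wins. At a final position both would have made the last
  move.\<close>

lemma wins_shift_disjoint:
  assumes "wins R P t M" "wins R Q (t + k) M" and disj: "\<And>s. \<not> (P s \<and> Q (s + k))"
  shows False
  using assms(1,2)
proof (induction rule: wins.induct)
  case (final M t)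
  then show ?case using disj wins_final by fastforce
next
  case (own t M N)
  then have "wins R Q (Suc (t + k)) N"
    using wins_other_step[of R Q "t + k" M N] disj by blast
  then show ?case using own by simp
next
  case (other t M N')
  then obtain N where "R M N" "wins R Q (Suc (t + k)) N"
    using wins_some_step[of R Q "t + k" M N'] by blast
  then show ?case using other by simp
qed

section \<open>Strategies in the Zeckendorf game\<close>

lemma zeckendorf_no_move:
  assumes "zeckendorf n M"
  shows "\<not> zmove M N"
proof
  assume mv: "zmove M N"
  obtain I where I: "finite I" "\<And>i. i \<in> I \<Longrightarrow> 1 \<le> i \<and> Suc i \<notin> I"
    and M: "M = image_mset zfib (mset_set I)"
    using assms unfolding zeckendorf_def by blast
  have inj: "inj_on zfib I" by (rule inj_on_subset[OF zfib_inj]) (use I(2) in auto)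
  have M': "M = mset_set (zfib ` I)" using M image_mset_mset_set[OF inj] by simp
  have cnt: "count M x \<le> 1" for x by (simp add: M' count_mset_set')
  \<comment> \<open>The condition \<open>1 \<le> i\<close> matters: \<open>zfib 0 = zfib 1\<close>,
    so a value determines its index only from 1 on.\<close>
  have mem: "i \<in> I" if "zfib i \<in># M" "1 \<le> i" for i
  proof -
    from that(1) I(1) obtain j where "j \<in> I" "zfib i = zfib j" by (auto simp: M)
    then show ?thesis using inj_onD[OF zfib_inj, of i j] that(2) I(2) by auto
  qed
  from mv show False
  proof cases
    case (combine i K)
    then have "i - 1 \<in> I" "i \<in> I" using mem[of "i - 1"] mem[of i] by auto
    then show False using I(2)[of "i - 1"] combine by simp
  next
    case (split1 K)
    then show False using cnt[of "zfib 1"] by simp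
  next
    case (split2 K)
    then show False using cnt[of "zfib 2"] by simp
  next
    case (split i K)
    then show False using cnt[of "zfib i"] by simp
  qed
qed

lemma zplay_snoc:
  assumes "h \<noteq> []"
  shows "zplay n (h @ [N]) \<longleftrightarrow> zplay n h \<and> \<not> zeckendorf n (last h) \<and> zmove (last h) N"
proof -
  have "(\<forall>k. Suc k < length (h @ [N]) \<longrightarrow> \<not> zeckendorf n ((h @ [N]) ! k)
            \<and> zmove ((h @ [N]) ! k) ((h @ [N]) ! Suc k)) \<longleftrightarrow>
        (\<forall>k. Suc k < length h \<longrightarrow> \<not> zeckendorf n (h ! k) \<and> zmove (h ! k) (h ! Suc k))
        \<and> \<not> zeckendorf n (last h) \<and> zmove (last h) N" (is "?L \<longleftrightarrow> ?R")
  proof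
    assume L: ?L
    have "\<not> zeckendorf n (h ! k) \<and> zmove (h ! k) (h ! Suc k)" if "Suc k < length h" for k
      using L[rule_format, of k] that by (simp add: nth_append)
    moreover have "\<not> zeckendorf n (last h) \<and> zmove (last h) N"
      using L[rule_format, of "length h - 1"] assms by (simp add: nth_append last_conv_nth)
    ultimately show ?R by blast
  next
    assume R: ?R
    show ?L
    proof (intro allI impI)
      fix k assume "Suc k < length (h @ [N])"
      then consider "Suc k < length h" | "length h = Suc k" by force
      then show "\<not> zeckendorf n ((h @ [N]) ! k) \<and> zmove ((h @ [N]) ! k) ((h @ [N]) ! Suc k)"
        by cases (use R assms in \<open>auto simp: nth_append last_conv_nth\<close>)
    qed
  qed
  then show ?thesis using assms by (simp add: zplay_def)
qed

lemma follows_snoc: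
  assumes "h \<noteq> []" "follows p A \<sigma> (h @ [N])"
  shows "follows p A \<sigma> h" "mover p (length h - 1) \<in> A \<Longrightarrow> N = \<sigma> h"
proof -
  have *: "(h @ [N]) ! Suc k = \<sigma> (take (Suc k) (h @ [N]))"
    if "Suc k < Suc (length h)" "mover p k \<in> A" for k
    using assms(2) that by (simp add: follows_def)
  show "follows p A \<sigma> h"
    unfolding follows_def
  proof (intro allI impI)
    fix k assume k: "Suc k < length h" "mover p k \<in> A"
    then show "h ! Suc k = \<sigma> (take (Suc k) h)" using *[of k] by (simp add: nth_append)
  qed
  show "N = \<sigma> h" if "mover p (length h - 1) \<in> A"
    using *[of "length h - 1"] that assms(1) by simp
qed

text \<open>The strategy picks any successor that is still won, so every play that follows it stays
  among won positions. The time is \<open>length h - 1\<close>, the number of moves made.\<close>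

lemma has_winning_strategy_if_wins:
  assumes "wins zmove (\<lambda>k. mover p k \<in> A) 0 (replicate_mset n 1)"
  shows "has_winning_strategy n p A"
proof -
  let ?W = "wins zmove (\<lambda>k. mover p k \<in> A)"
  define \<sigma> where "\<sigma> h = (SOME N. zmove (last h) N \<and> ?W (length h) N)" for h
  have \<sigma>: "zmove (last h) (\<sigma> h) \<and> ?W (length h) (\<sigma> h)"
    if "h \<noteq> []" "?W (length h - 1) (last h)" "zmove (last h) N" for h N
    unfolding \<sigma>_def
    by (rule someI_ex) (use wins_some_step[OF that(2,3)] that(1) in simp)
  have W: "?W (length h - 1) (last h)" if "zplay n h" "follows p A \<sigma> h" for h
    using that
  proof (induction h rule: rev_induct)
    case Nil
    then show ?case by (simp add: zplay_def)
  next
    case (snoc N h)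
    show ?case
    proof (cases "h = []")
      case True
      then show ?thesis using snoc.prems assms by (simp add: zplay_def)
    next
      case False
      then have IH: "?W (length h - 1) (last h)" and mv: "zmove (last h) N"
        using snoc follows_snoc(1)[OF False] by (auto simp: zplay_snoc)
      show ?thesis
      proof (cases "mover p (length h - 1) \<in> A")
        case True
        then show ?thesis using \<sigma>[OF False IH mv] follows_snoc(2)[OF False snoc.prems(2)] by simp
      next
        case oth: False
        then show ?thesis using wins_other_step[OF IH _ mv] False by simp
      qed
    qed
  qed
  have "winning_strategy n p A \<sigma>"
    unfolding winning_strategy_def
  proof (intro conjI allI impI; (elim conjE)?)
    fix h assume h: "zplay n h" "follows p A \<sigma> h" "\<not> finished n h"
    then obtain N where "zmove (last h) N"
      using zplay_progress by (auto simp: finished_def)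
    then show "zmove (last h) (\<sigma> h)" using \<sigma> W h by (auto simp: zplay_def)
  next
    fix h assume h: "finished n h" "follows p A \<sigma> h"
    then have "?W (length h - 1) (last h)" "\<nexists>N. zmove (last h) N"
      using W zeckendorf_no_move by (auto simp: finished_def)
    then obtain s where s: "length h - 1 = Suc s" "mover p s \<in> A"
      using wins_final[of zmove "\<lambda>k. mover p k \<in> A" "length h - 1" "last h"] by blast
    then have "length h - 2 = s" by simp
    then show "2 \<le> length h" "mover p (length h - 2) \<in> A" using s by simp_all
  qed
  then show ?thesis by (auto simp: has_winning_strategy_def)
qed

text \<open>At time \<open>0\<close> a final position is won by nobody, hence the second premise.\<close>
lemma zeckendorf_game_determined:
  assumes "zplay n h" "length h = 1 \<Longrightarrow> \<not> zeckendorf n (last h)"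
  shows "wins zmove P (length h - 1) (last h) \<or> wins zmove (\<lambda>k. \<not> P k) (length h - 1) (last h)"
  using assms
\<comment> \<open>Plays have at most \<open>n\<^sup>2 + 1\<close> positions, so this measure drops
  with each move.\<close>
proof (induction "n\<^sup>2 + 1 - length h" arbitrary: h rule: less_induct)
  case less
  define t where "t = length h - 1"
  have h: "h \<noteq> []" using less.prems by (simp add: zplay_def)
  then have len: "length h = Suc t" by (simp add: t_def)
  show ?case
  proof (cases "zeckendorf n (last h)")
    case True
    then have "t \<noteq> 0" using less.prems len by auto
    then obtain s where "t = Suc s" using not0_implies_Suc by blast
    moreover have "\<nexists>N. zmove (last h) N" using zeckendorf_no_move True by blast
    ultimately show ?thesis
      using wins.final[where R = zmove and M = "last h" and P = P and t = s]
        wins.final[where R = zmove and M = "last h" and P = "\<lambda>k. \<not> P k" and t = s] len by auto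
  next
    case False
    then obtain N' where N': "zmove (last h) N'" using zplay_progress less.prems by blast
    have IH: "wins zmove P (Suc t) N \<or> wins zmove (\<lambda>k. \<not> P k) (Suc t) N"
      if "zmove (last h) N" for N
    proof -
      have play: "zplay n (h @ [N])" using that False less.prems h by (simp add: zplay_snoc)
      have "n\<^sup>2 + 1 - length (h @ [N]) < n\<^sup>2 + 1 - length h"
        using zplay_length_le[OF play] by simp
      from less.hyps[OF this play] show ?thesis using len by simp
    qed
    show ?thesis
    proof (cases "P t")
      case True
      show ?thesis
      proof (cases "\<exists>N. zmove (last h) N \<and> wins zmove P (Suc t) N")
        case ex: True
        then show ?thesis using wins.own[of P t zmove "last h"] True len by auto
      next
        case False
        then have "wins zmove (\<lambda>k. \<not> P k) t (last h)"
          using wins.other[of "\<lambda>k. \<not> P k" t zmove "last h" N'] N' True IH by blast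
        then show ?thesis using len by simp
      qed
    next
      case nP: False
      show ?thesis
      proof (cases "\<exists>N. zmove (last h) N \<and> wins zmove (\<lambda>k. \<not> P k) (Suc t) N")
        case ex: True
        then show ?thesis using wins.own[of "\<lambda>k. \<not> P k" t zmove "last h"] nP len by auto
      next
        case False
        then have "wins zmove P t (last h)"
          using wins.other[of P t zmove "last h" N'] N' nP IH by blast
        then show ?thesis using len by simp
      qed
    qed
  qed
qed

section \<open>Detours\<close>

lemma zmove_11: "zmove (add_mset 1 (add_mset 1 K)) (add_mset 2 K)"
  using zmove.split1[of K] by (simp add: numeral_2_eq_2)

lemma zmove_12: "zmove (add_mset 1 (add_mset 2 K)) (add_mset 3 K)"
  using zmove.combine[of 2 K] by (simp add: numeral_2_eq_2 numeral_3_eq_3 add_mset_commute)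

lemma zmove_22: "zmove (add_mset 2 (add_mset 2 K)) (add_mset 1 (add_mset 3 K))"
  using zmove.split2[of K] by (simp add: numeral_2_eq_2 numeral_3_eq_3 add_mset_commute)

lemma zmove_count_le: "zmove M N \<Longrightarrow> count M x \<le> count N x + 2"
  by (induction rule: zmove.induct) auto

lemma replicate_mset_split:
  assumes "k \<le> count M x"
  obtains K where "M = replicate_mset k x + K"
  using assms by (metis count_le_replicate_mset_subset_eq subset_mset.add_diff_inverse)

lemma two_ones_split:
  assumes "2 \<le> count M 1"
  obtains K where "M = add_mset 1 (add_mset (1::nat) K)"
  using replicate_mset_split[OF assms] by (auto simp: numeral_2_eq_2)

text \<open>The position is only known up to what the opponents may have destroyed, so we merely keep
  lower bounds on the numbers of 1s and 2s.\<close>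
lemma wins_steps:
  assumes "wins zmove P t M" "2 * j \<le> count M 1"
  shows "\<exists>N. wins zmove P (t + j) N \<and> count M 1 \<le> count N 1 + 2 * j \<and> count M 2 \<le> count N 2 + 2 * j"
  using assms(2)
proof (induction j)
  case 0
  then show ?case using assms(1) by auto
next
  case (Suc j)
  then obtain N where N: "wins zmove P (t + j) N" "count M 1 \<le> count N 1 + 2 * j"
    "count M 2 \<le> count N 2 + 2 * j" by auto
  then obtain K where "N = add_mset 1 (add_mset 1 K)"
    using Suc.prems two_ones_split[of N] by auto
  \<comment> \<open>\<open>zmove_11\<close> only shows that some move exists; \<open>N'\<close> may
    arise from a different one.\<close>
  then obtain N' where N': "zmove N N'" "wins zmove P (Suc (t + j)) N'"
    using wins_some_step[OF N(1)] zmove_11 by blast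
  then show ?case
    using N zmove_count_le[OF N'(1), of 1] zmove_count_le[OF N'(1), of 2] by auto
qed

text \<open>All movers here oppose \<open>P\<close>, so each of them is free to merge two 1s; hence
  the exact count of 1s.\<close>

lemma wins_make_twos:
  assumes "wins zmove P t M" "2 * j \<le> count M 1" "\<And>i. i < j \<Longrightarrow> \<not> P (t + i)"
  shows "\<exists>N. wins zmove P (t + j) N \<and> count N 1 + 2 * j = count M 1 \<and> j \<le> count N 2"
  using assms(2,3)
proof (induction j)
  case 0
  then show ?case using assms(1) by auto
next
  case (Suc j)
  then obtain N where N: "wins zmove P (t + j) N" "count N 1 + 2 * j = count M 1" "j \<le> count N 2"
    by force
  then obtain K where K: "N = add_mset 1 (add_mset 1 K)"
    using Suc.prems two_ones_split[of N] by auto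
  have "wins zmove P (Suc (t + j)) (add_mset 2 K)"
    using wins_other_step[OF N(1)] Suc.prems(2)[of j] K zmove_11 by auto
  then show ?case using N K by (intro exI[of _ "add_mset 2 K"]) auto
qed

text \<open>Both routes start 1111 -> 112. The short one then merges 1 and 2; the long one makes 22
  and splits it into 13.\<close>

lemma wins_detour:
  assumes W: "wins zmove P t (replicate_mset 4 1 + K)" and P: "\<not> P t" "\<not> P (t + 1)"
  shows "wins zmove P (t + 2) ({#1, 3#} + K)"
    and "\<not> P (t + 2) \<Longrightarrow> wins zmove P (t + 3) ({#1, 3#} + K)"
proof -
  have "wins zmove P (t + 1) ({#1, 1, 2#} + K)"
    using wins_other_step[OF W P(1)] zmove_11[of "{#1, 1#} + K"]
    by (simp add: eval_nat_numeral add_mset_commute)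
  note W1 = wins_other_step[OF this P(2)]
  show "wins zmove P (t + 2) ({#1, 3#} + K)"
    using W1[of "{#1, 3#} + K"] zmove_12[of "{#1#} + K"] by (simp add: add_mset_commute)
  have W2: "wins zmove P (t + 2) ({#2, 2#} + K)"
    using W1[of "{#2, 2#} + K"] zmove_11[of "{#2#} + K"] by (simp add: add_mset_commute)
  show "wins zmove P (t + 3) ({#1, 3#} + K)" if "\<not> P (t + 2)"
    using wins_other_step[OF W2 that, of "{#1, 3#} + K"] zmove_22[of K]
    by (simp add: eval_nat_numeral add_mset_commute)
qed

lemma no_win_three_in_row:
  assumes "wins zmove P t M" "4 \<le> count M 1" "\<And>i. i < 3 \<Longrightarrow> \<not> P (t + i)"
    and disj: "\<And>s. \<not> (P s \<and> P (s + 1))"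
  shows False
proof -
  obtain K where K: "M = replicate_mset 4 1 + K" using assms(2) by (rule replicate_mset_split)
  have "\<not> P t" "\<not> P (t + 1)" "\<not> P (t + 2)"
    using assms(3)[of 0] assms(3)[of 1] assms(3)[of 2] by auto
  then have "wins zmove P (t + 2) ({#1, 3#} + K)" "wins zmove P (t + 2 + 1) ({#1, 3#} + K)"
    using wins_detour[of P t K] assms(1) K by (auto simp: eval_nat_numeral)
  then show False using disj by (rule wins_shift_disjoint)
qed

text \<open>Two short detours take four moves, two long ones six, and both turn eight 1s into 1, 1,
  3, 3.\<close>

lemma no_win_six_in_row:
  assumes "wins zmove P t M" "8 \<le> count M 1" "\<And>i. i < 6 \<Longrightarrow> \<not> P (t + i)"
    and disj: "\<And>s. \<not> (P s \<and> P (s + 2))"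
  shows False
proof -
  obtain K where K: "M = replicate_mset 8 1 + K" using assms(2) by (rule replicate_mset_split)
  let ?K1 = "replicate_mset 4 1 + K" and ?K2 = "{#1, 3#} + K"
  have W: "wins zmove P t (replicate_mset 4 1 + ?K1)"
    using assms(1) K by (simp add: eval_nat_numeral)
  have sw: "{#1, 3#} + ?K1 = replicate_mset 4 1 + ?K2" by (simp add: ac_simps)
  have nP: "\<not> P t" "\<not> P (t + 1)" "\<not> P (t + 2)" "\<not> P (t + 3)" "\<not> P (t + 4)" "\<not> P (t + 5)"
    using assms(3)[of 0] assms(3)[of 1] assms(3)[of 2] assms(3)[of 3] assms(3)[of 4] assms(3)[of 5]
    by auto
  have "wins zmove P (t + 2) (replicate_mset 4 1 + ?K2)"
    "wins zmove P (t + 3) (replicate_mset 4 1 + ?K2)"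
    using wins_detour[OF W] nP sw by auto
  from wins_detour(1)[OF this(1)] wins_detour(2)[OF this(2)]
  have "wins zmove P (t + 4) ({#1, 3#} + ?K2)" "wins zmove P (t + 4 + 2) ({#1, 3#} + ?K2)"
    using nP by (simp_all add: eval_nat_numeral)
  then show False using disj by (rule wins_shift_disjoint)
qed

text \<open>After the common move to 111122, the short route is 11123 -> 1133, the long one 11222 ->
  2222 -> 1223 -> 1133.\<close>

lemma no_win_five_in_row:
  assumes "wins zmove P t M" "6 \<le> count M 1" "1 \<le> count M 2" "\<And>i. i < 5 \<Longrightarrow> \<not> P (t + i)"
    and disj: "\<And>s. \<not> (P s \<and> P (s + 2))"
  shows False
proof -
  obtain K1 where K1: "M = replicate_mset 6 1 + K1" using assms(2) by (rule replicate_mset_split)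
  then have "1 \<le> count K1 2" using assms(3) by simp
  then obtain K where "K1 = add_mset 2 K" by (metis One_nat_def Suc_le_eq count_greater_zero_iff insert_DiffM)
  then have W0: "wins zmove P t ({#1, 1, 1, 1, 1, 1, 2#} + K)"
    using assms(1) K1 by (simp add: eval_nat_numeral add_mset_commute)
  have nP: "\<not> P t" "\<not> P (t + 1)" "\<not> P (t + 2)" "\<not> P (t + 3)" "\<not> P (t + 4)"
    using assms(4)[of 0] assms(4)[of 1] assms(4)[of 2] assms(4)[of 3] assms(4)[of 4] by auto
  have "wins zmove P (t + 1) ({#1, 1, 1, 1, 2, 2#} + K)"
    using wins_other_step[OF W0 nP(1)] zmove_11[of "{#1, 1, 1, 1, 2#} + K"]
    by (simp add: add_mset_commute)
  note W1 = wins_other_step[OF this nP(2)]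
  have "wins zmove P (t + 2) ({#1, 1, 1, 2, 3#} + K)"
    using W1[of "{#1, 1, 1, 2, 3#} + K"] zmove_12[of "{#1, 1, 1, 2#} + K"]
    by (simp add: add_mset_commute)
  from wins_other_step[OF this nP(3)]
  have short: "wins zmove P (t + 3) ({#1, 1, 3, 3#} + K)"
    using zmove_12[of "{#1, 1, 3#} + K"] by (simp add: add_mset_commute eval_nat_numeral)
  have "wins zmove P (t + 2) ({#1, 1, 2, 2, 2#} + K)"
    using W1[of "{#1, 1, 2, 2, 2#} + K"] zmove_11[of "{#1, 1, 2, 2#} + K"]
    by (simp add: add_mset_commute)
  from wins_other_step[OF this nP(3)]
  have "wins zmove P (t + 3) ({#2, 2, 2, 2#} + K)"
    using zmove_11[of "{#2, 2, 2#} + K"] by (simp add: add_mset_commute eval_nat_numeral)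
  from wins_other_step[OF this nP(4)]
  have "wins zmove P (t + 4) ({#1, 2, 2, 3#} + K)"
    using zmove_22[of "{#2, 2#} + K"] by (simp add: add_mset_commute eval_nat_numeral)
  from wins_other_step[OF this nP(5)]
  have "wins zmove P (t + 3 + 2) ({#1, 1, 3, 3#} + K)"
    using zmove_22[of "{#1, 3#} + K"] by (simp add: add_mset_commute eval_nat_numeral)
  with short show False using disj by (rule wins_shift_disjoint)
qed

section \<open>Two small players\<close>

lemma mod_less_twice:
  fixes x p :: nat
  assumes "x < 2 * p"
  shows "x mod p = (if x < p then x else x - p)"
  using assms by (simp add: le_mod_geq)

text \<open>The split is by whether the seats, counted from 0 around the table, are neighbours, and
  then by \<open>8 \<le> p\<close>. The caps on \<open>s\<close> bound the number of 1s lost before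
  the detour.\<close>

lemma small_seats_cases:
  fixes p a b :: nat
  assumes "7 \<le> p" "a < b" "b < p" and P: "\<And>k. P k \<longleftrightarrow> k mod p = a \<or> k mod p = b"
  obtains (apart) s where "s \<le> 6" "\<And>i. i < 3 \<Longrightarrow> \<not> P (s + i)" "\<And>k. \<not> (P k \<and> P (k + 1))"
  | (six) s where "s \<le> 7" "\<And>i. i < 6 \<Longrightarrow> \<not> P (s + i)" "\<And>k. \<not> (P k \<and> P (k + 2))"
  | (five) s where "s \<le> 6" "\<And>i. i < 5 \<Longrightarrow> \<not> P (s + i)" "\<And>i. i < 5 \<Longrightarrow> \<not> P (s + 7 + i)"
      "\<And>k. \<not> (P k \<and> P (k + 2))"
proof -
  \<comment> \<open>A free stretch may run past the end of a round, so two rounds are made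
    explicit.\<close>
  have small: "P k \<longleftrightarrow> k = a \<or> k = b \<or> k = a + p \<or> k = b + p" if "k < 2 * p" for k
    using that assms by (auto simp: P mod_less_twice)
  have "P (k + d) \<longleftrightarrow> P (k mod p + d)" for k d
    by (simp add: P mod_add_left_eq)
  moreover have "P k \<longleftrightarrow> P (k mod p)" for k by (simp add: P)
  ultimately have red: "\<exists>k < p. P k \<and> P (k + d)" if "P k \<and> P (k + d)" for k d
    using that assms(1) by (intro exI[of _ "k mod p"]) auto
  define adj where "adj \<longleftrightarrow> b = a + 1 \<or> (a = 0 \<and> b = p - 1)"
  show thesis
  proof (cases adj)
    case False
    have disj: "\<not> (P k \<and> P (k + 1))" for k
    proof
      assume "P k \<and> P (k + 1)"
      then obtain k where "k < p" "P k" "P (k + 1)" using red by blast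
      then show False using small[of k] small[of "k + 1"] False assms by (auto simp: adj_def)
    qed
    \<comment> \<open>The stretch lies before \<open>a\<close>, between the seats, or after
      \<open>b\<close>; in the last case \<open>b - a \<le> 3\<close>, so it ends before
      \<open>a + p\<close>.\<close>
    define s where "s = (if 3 \<le> a then 0 else if 4 \<le> b - a then a + 1 else b + 1)"
    have "\<not> P (s + i)" if "i < 3" for i
      using small[of "s + i"] that assms by (auto simp: s_def split: if_splits)
    moreover have "s \<le> 6" by (auto simp: s_def)
    ultimately show ?thesis using apart disj by blast
  next
    case True
    have disj: "\<not> (P k \<and> P (k + 2))" for k
    proof
      assume "P k \<and> P (k + 2)"
      then obtain k where "k < p" "P k" "P (k + 2)" using red by blast
      moreover have "k + 2 < 2 * p" using \<open>k < p\<close> assms(1) by simp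
      ultimately have "k = a \<or> k = b" "k + 2 = a \<or> k + 2 = b \<or> k + 2 = a + p \<or> k + 2 = b + p"
        using small[of k] small[of "k + 2"] by auto
      then show False using True assms(1-3) unfolding adj_def by linarith
    qed
    show ?thesis
    proof (cases "8 \<le> p")
      case p: True
      \<comment> \<open>The last branch is the pair \<open>0\<close>, \<open>p - 1\<close>, with
        seats \<open>1\<close> to \<open>p - 2\<close> free.\<close>
      define s where "s = (if 6 \<le> a then 0 else if b = a + 1 then b + 1 else 1)"
      have "\<not> P (s + i)" if "i < 6" for i
        using small[of "s + i"] that assms p True by (auto simp: s_def adj_def split: if_splits)
      moreover have "s \<le> 7" by (auto simp: s_def)
      ultimately show ?thesis using six disj by blast
    next
      case False
      then have p: "p = 7" using assms by simp
      \<comment> \<open>For the seats 5 and 6, starting at 0 instead of \<open>b + 1\<close> keeps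
        \<open>s \<le> 6\<close>.\<close>
      define s where "s = (if a = 5 then 0 else if b = a + 1 then b + 1 else 1)"
      have s: "\<not> P (s + i)" if "i < 5" for i
        using small[of "s + i"] that assms p True by (auto simp: s_def adj_def split: if_splits)
      have "P (k + 7) \<longleftrightarrow> P k" for k by (simp add: P p)
      then have "\<not> P (s + 7 + i)" if "i < 5" for i
        using s[OF that] by (metis add.commute add.left_commute)
      moreover have "s \<le> 6" using assms p by (auto simp: s_def)
      ultimately show ?thesis using five s disj by blast
    qed
  qed
qed

lemma two_players_do_not_win:
  assumes "32 \<le> n" "7 \<le> p" "a < b" "b < p" and P: "\<And>k. P k \<longleftrightarrow> k mod p = a \<or> k mod p = b"
  shows "\<not> wins zmove P 0 (replicate_mset n 1)"
proof
  assume W: "wins zmove P 0 (replicate_mset n 1)"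
  have steps: "\<exists>N. wins zmove P s N \<and> n \<le> count N 1 + 2 * s" if "s \<le> 7" for s
    using wins_steps[OF W, of s] that assms(1) by auto
  from assms(2-) show False
  proof (cases rule: small_seats_cases)
    case (apart s)
    then obtain N where "wins zmove P s N" "n \<le> count N 1 + 2 * s" using steps[of s] by auto
    then show False using no_win_three_in_row[of P s N] apart assms(1) by auto
  next
    case (six s)
    then obtain N where "wins zmove P s N" "n \<le> count N 1 + 2 * s" using steps[of s] by auto
    then show False using no_win_six_in_row[of P s N] six assms(1) by auto
  next
    case (five s)
    then obtain N where N: "wins zmove P s N" "n \<le> count N 1 + 2 * s" using steps[of s] by auto
    \<comment> \<open>Here 32 is just enough: at least 20 1s remain at time \<open>s\<close>, the
      five merges leave 10 and create five 2s, and the next two moves remove at most four of each,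
      leaving six 1s and one 2.\<close>
    then obtain N1 where N1: "wins zmove P (s + 5) N1" "count N1 1 + 10 = count N 1" "5 \<le> count N1 2"
      using wins_make_twos[of P s N 5] five assms(1) by auto
    then obtain N2 where N2: "wins zmove P (s + 7) N2" "count N1 1 \<le> count N2 1 + 4"
      "count N1 2 \<le> count N2 2 + 4"
      using wins_steps[of P "s + 5" N1 2] five N assms(1) by (auto simp: add.commute)
    then have "6 \<le> count N2 1" "1 \<le> count N2 2" using five(1) N(2) N1(2,3) assms(1) by linarith+
    then show False using no_win_five_in_row[OF N2(1)] five(3,4) by blast
  qed
qed

theorem theorem1p3p4:
  fixes n p :: nat and Big Small :: "nat set"
  assumes "n \<ge> 32" and "p \<ge> 7"
    and "Big \<union> Small = {1..p}" and "Big \<inter> Small = {}"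
    and "card Big = p - 2" and "card Small = 2"
  shows "has_winning_strategy n p Big"
proof -
  let ?one = "replicate_mset n (1::nat)" and ?P = "\<lambda>k. mover p k \<in> Small"
  obtain x y where xy: "Small = {x, y}" "x < y"
    using assms(6) by (metis card_2_iff insert_commute linorder_neqE_nat)
  then have range: "1 \<le> x" "y \<le> p" using assms(3) by auto
  \<comment> \<open>\<open>mover\<close> numbers players from 1, seats are counted from 0.\<close>
  have "?P k \<longleftrightarrow> k mod p = x - 1 \<or> k mod p = y - 1" for k
    using xy range by (auto simp: mover_def)
  then have no: "\<not> wins zmove ?P 0 ?one"
    using two_players_do_not_win[of n p "x - 1" "y - 1" ?P] assms(1,2) xy range by auto
  have "mover p k \<in> {1..p}" for k
    using assms(2) mod_less_divisor[of p k] by (auto simp: mover_def Suc_le_eq simp del: mod_less_divisor)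
  then have Big: "(\<lambda>k. \<not> ?P k) = (\<lambda>k. mover p k \<in> Big)"
    using assms(3,4) by fastforce
  \<comment> \<open>Determinacy at time 0 requires that the start is not already final; a possible
    move shows this.\<close>
  obtain K where "?one = add_mset 1 (add_mset 1 K)"
    using two_ones_split[of ?one] assms(1) by auto
  then have "\<not> zeckendorf n ?one" using zeckendorf_no_move zmove_11 by metis
  then have "wins zmove (\<lambda>k. mover p k \<in> Big) 0 ?one"
    using zeckendorf_game_determined[of n "[?one]" ?P] no Big by (simp add: zplay_def)
  then show ?thesis by (rule has_winning_strategy_if_wins)
qed

end
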